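(* There exist constants $c>0$ and $m_0$ such that for every integer $m\ge m_0$ there is an instance of independent identically distributed random variables $X_1,\dots,X_n$ (for some $n$) on which every algorithm in the oracle model with $m$ oracle calls selects the maximum realization $\max_i X_i$ with probability at most $1-c\,m^{-m}$.
   Context: Oracle model with $m$ calls: the common (continuous) distribution of $X_1,\dots,X_n$ is known to the algorithm; realizations are revealed one at a time in the order $X_1,\dots,X_n$, and the algorithm may select at most one value, irrevocably at the time it is observed. At most $m$ times, after observing the current realization $X_i$ and before deciding on it, it may query an oracle, which answers YES if $X_i>\max_{j=i+1}^n X_j$ and NO otherwise. *)

theory Defs
  imports "HOL-Probability.Probability"
begin

text \<open>
  A (possibly randomised) online algorithm. Its internal randomness is one real number \<open>u\<close>, drawn
  from \<open>seed\<close> independently of the realizations; every standard Borel source of randomness can be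
  encoded this way. The decision rules receive the step \<open>i\<close>, the seed \<open>u\<close>, the values observed so
  far (a function on \<open>{1..i}\<close>, \<open>undefined\<close> elsewhere) and the transcript of calls, a list
  with one entry per step: \<open>None\<close> if no call was made at that step, \<open>Some b\<close> if the answer was \<open>b\<close>.
  The transcript passed to \<open>asks\<close> at step \<open>i\<close> covers the steps before \<open>i\<close>, the one passed to
  \<open>takes\<close> covers step \<open>i\<close> as well.
\<close>

record algorithm =
  seed :: "real measure"
  asks :: "nat \<Rightarrow> real \<Rightarrow> (nat \<Rightarrow> real) \<Rightarrow> bool option list \<Rightarrow> bool"
  takes :: "nat \<Rightarrow> real \<Rightarrow> (nat \<Rightarrow> real) \<Rightarrow> bool option list \<Rightarrow> bool"

definition is_algorithm :: "nat \<Rightarrow> algorithm \<Rightarrow> bool" where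
  "is_algorithm n A \<longleftrightarrow>
     real_distribution (seed A) \<and>
     (\<forall>i\<in>{1..n}. \<forall>h.
        Measurable.pred (borel \<Otimes>\<^sub>M (\<Pi>\<^sub>M j\<in>{1..i}. borel)) (\<lambda>(u, x). asks A i u x h) \<and>
        Measurable.pred (borel \<Otimes>\<^sub>M (\<Pi>\<^sub>M j\<in>{1..i}. borel)) (\<lambda>(u, x). takes A i u x h))"

text \<open>The maximum over no values is \<open>-\<infinity>\<close>: at step \<open>n\<close> the answer is YES.\<close>

definition oracle_yes :: "nat \<Rightarrow> (nat \<Rightarrow> real) \<Rightarrow> nat \<Rightarrow> bool" where
  "oracle_yes n x i \<longleftrightarrow> (\<forall>j\<in>{i+1..n}. x i > x j)"

definition calls :: "bool option list \<Rightarrow> nat" where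
  "calls h = length (filter (\<lambda>r. r \<noteq> None) h)"

text \<open>
  The transcript of the first \<open>k\<close> steps on the realizations \<open>x 1, \<dots>, x n\<close>. The budget of
  \<open>m\<close> calls is part of the model: once it is used up, requests remain unanswered. The transcript
  is continued formally after a selection, which has no effect on the value selected.
\<close>

primrec transcript :: "nat \<Rightarrow> nat \<Rightarrow> algorithm \<Rightarrow> real \<Rightarrow> (nat \<Rightarrow> real) \<Rightarrow> nat \<Rightarrow> bool option list" where
  "transcript m n A u x 0 = []"
| "transcript m n A u x (Suc k) =
     (let h = transcript m n A u x k in
      h @ [if calls h < m \<and> asks A (Suc k) u (restrict x {1..Suc k}) h
           then Some (oracle_yes n x (Suc k)) else None])"

definition accepts :: "nat \<Rightarrow> nat \<Rightarrow> algorithm \<Rightarrow> real \<Rightarrow> (nat \<Rightarrow> real) \<Rightarrow> nat \<Rightarrow> bool" where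
  "accepts m n A u x i \<longleftrightarrow> takes A i u (restrict x {1..i}) (transcript m n A u x i)"

definition selects :: "nat \<Rightarrow> nat \<Rightarrow> algorithm \<Rightarrow> real \<Rightarrow> (nat \<Rightarrow> real) \<Rightarrow> nat \<Rightarrow> bool" where
  "selects m n A u x i \<longleftrightarrow>
     i \<in> {1..n} \<and> accepts m n A u x i \<and> (\<forall>k\<in>{1..<i}. \<not> accepts m n A u x k)"

definition success_prob :: "nat \<Rightarrow> nat \<Rightarrow> real measure \<Rightarrow> algorithm \<Rightarrow> real" where
  "success_prob m n D A =
     \<P>((u, x) in seed A \<Otimes>\<^sub>M (\<Pi>\<^sub>M j\<in>{1..n}. D).
        \<exists>i. selects m n A u x i \<and> x i = Max (x ` {1..n}))"

end

theory Submission
  imports Defs "HOL-Real_Asymp.Real_Asymp"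
begin

text \<open>
  Take \<open>m + 2\<close> uniform values on \<open>[0, 1]\<close> and restrict attention to increasing sequences in \<open>(b/2, b)\<close>.
  Along such a sequence every answer is NO, so at some step \<open>i \<le> m + 1\<close> the algorithm first
  decides without an answer, or selects in spite of the answer NO. If the current value is \<open>s\<close>,
  then selecting it is a mistake if some later value exceeds \<open>s\<close>, and rejecting it is a mistake if
  all \<open>k\<close> later values are below \<open>s\<close>. These events have conditional probability \<open>1 - s ^ k\<close> and \<open>s ^ k\<close>,
  hence at least \<open>1 - b\<close> times the probability \<open>(b - s) ^ k\<close> that all later values are in
  \<open>(s, b)\<close>, because \<open>s \<ge> b - s\<close>. Summing over \<open>i\<close>, the algorithm fails with probability at least
  \<open>(1 - b) (b/2) ^ (m + 2) / (m + 2)!\<close>, which dominates \<open>1 / m ^ m\<close> as soon as \<open>b/2 > 1/e\<close>.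
\<close>

section \<open>The uniform distribution on the unit interval\<close>

abbreviation unif :: "real measure" where
  "unif \<equiv> uniform_measure lborel {0..1}"

lemma prob_space_unif: "prob_space unif"
  by (rule prob_space_uniform_measure) auto

lemma emeasure_unif: "A \<in> sets borel \<Longrightarrow> A \<subseteq> {0..1} \<Longrightarrow> emeasure unif A = emeasure lborel A"
  by (simp add: Int_absorb1 divide_ennreal_def)

lemma real_distribution_unif: "real_distribution unif"
  by (simp add: real_distribution_def real_distribution_axioms_def prob_space_unif)

lemma continuous_cdf_unif: "continuous_on UNIV (cdf unif)"
proof -
  interpret real_distribution unif by (rule real_distribution_unif)
  have "emeasure unif {x} \<le> 0" for x
  proof -
    have "emeasure lborel ({0..1} \<inter> {x}) \<le> emeasure lborel {x}"
      by (intro emeasure_mono) auto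
    then show ?thesis by simp
  qed
  then have "measure unif {x} = 0" for x by (simp add: measure_def)
  then show ?thesis
    by (simp add: continuous_on_eq_continuous_at isCont_cdf)
qed

lemma product_sigma_finite_unif: "product_sigma_finite (\<lambda>_. unif)"
  by (simp add: product_sigma_finite_def prob_space_imp_sigma_finite prob_space_unif)

lemma prob_space_PiM_unif: "prob_space (PiM I (\<lambda>_. unif))"
  by (intro prob_space_PiM prob_space_unif)

lemma sets_PiM_unif: "sets (PiM I (\<lambda>_. unif)) = sets (PiM I (\<lambda>_. borel))"
  by (intro sets_PiM_cong) auto

section \<open>The probability of an increasing sequence\<close>

lemma strict_mono_on_pred [measurable]:
  "Measurable.pred (PiM {1..k} (\<lambda>_. unif)) (\<lambda>x. strict_mono_on {1..k::nat} x)"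
  unfolding strict_mono_on_def by measurable

text \<open>Integrating out the last and hence largest value \<open>y\<close> leaves a shorter chain
  in \<open>(a, y)\<close>, so the volume is an iterated integral of powers. The upper end
  \<open>t\<close> is generalised in the induction because \<open>y\<close> takes its place.\<close>

lemma emeasure_chain:
  assumes "0 \<le> a" "a \<le> t" "t \<le> 1"
  shows "emeasure (PiM {1..k} (\<lambda>_. unif))
    {x\<in>space (PiM {1..k} (\<lambda>_. unif)). strict_mono_on {1..k} x \<and> (\<forall>j\<in>{1..k}. a < x j \<and> x j < t)}
    = ennreal ((t - a) ^ k / fact k)"
  using assms
proof (induction k arbitrary: t)
  case 0
  show ?case by (simp add: PiM_empty strict_mono_on_def)
next
  case (Suc k)
  interpret product_sigma_finite "\<lambda>_::nat. unif" by (rule product_sigma_finite_unif)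
  interpret unif: prob_space unif by (rule prob_space_unif)
  let ?C = "\<lambda>k t. {x\<in>space (PiM {1..k} (\<lambda>_. unif)). strict_mono_on {1..k} x \<and> (\<forall>j\<in>{1..k}. a < x j \<and> x j < t)}"
  let ?M = "\<lambda>k::nat. PiM {1..k} (\<lambda>_. unif)"
  have ins: "{1..Suc k} = insert (Suc k) {1..k}" by auto
  have C[measurable]: "?C k t \<in> sets (?M k)" for k t by measurable
  have "emeasure (?M (Suc k)) (?C (Suc k) t) = (\<integral>\<^sup>+x. indicator (?C (Suc k) t) x \<partial>?M (Suc k))"
    by (rule nn_integral_indicator [OF C, symmetric])
  also have "\<dots> = (\<integral>\<^sup>+y. (\<integral>\<^sup>+x. indicator (?C (Suc k) t) (x(Suc k := y)) \<partial>?M k) \<partial>unif)"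
    using C[of "Suc k" t] unfolding ins
    by (intro product_nn_integral_insert_rev) auto
  \<comment> \<open>The bound \<open>x j < t\<close> on the earlier values follows from
    \<open>x j < y\<close> and \<open>y < t\<close>, so the inner event depends on \<open>y\<close>
    alone.\<close>
  also have "\<dots> = (\<integral>\<^sup>+y. (\<integral>\<^sup>+x. indicator {a<..<t} y * indicator (?C k y) x \<partial>?M k) \<partial>unif)"
  proof (intro nn_integral_cong)
    fix y x assume x: "x \<in> space (?M k)"
    have "x(Suc k := y) \<in> space (?M (Suc k))"
      using x by (auto simp: space_PiM PiE_def extensional_def)
    moreover have "strict_mono_on {1..Suc k} (x(Suc k := y)) \<longleftrightarrow> strict_mono_on {1..k} x \<and> (\<forall>j\<in>{1..k}. x j < y)"
      by (fastforce simp: strict_mono_on_def le_Suc_eq)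
    ultimately have "x(Suc k := y) \<in> ?C (Suc k) t \<longleftrightarrow> y \<in> {a<..<t} \<and> x \<in> ?C k y"
      using x by (force simp: ins)
    then show "indicator (?C (Suc k) t) (x(Suc k := y)) = (indicator {a<..<t} y * indicator (?C k y) x :: ennreal)"
      by (auto simp: indicator_def)
  qed
  also have "\<dots> = (\<integral>\<^sup>+y. indicator {a<..<t} y * emeasure (?M k) (?C k y) \<partial>unif)"
    by (intro nn_integral_cong) (simp add: nn_integral_cmult nn_integral_indicator [OF C] del: One_nat_def)
  also have "\<dots> = (\<integral>\<^sup>+y. ennreal ((y - a) ^ k / fact k) * indicator {a<..<t} y \<partial>unif)"
    using Suc by (intro nn_integral_cong) (auto simp: indicator_def)
  also have "\<dots> = (\<integral>\<^sup>+y. ennreal ((y - a) ^ k / fact k) * indicator {a<..<t} y * indicator {0..1} y \<partial>lborel)"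
    by (subst nn_integral_uniform_measure) (auto simp: divide_ennreal_def)
  \<comment> \<open>The endpoints are null sets, and \<open>(a, t)\<close> lies within the unit
    interval. The closed interval is the form required by the fundamental theorem of
    calculus.\<close>
  also have "\<dots> = (\<integral>\<^sup>+y. ennreal ((y - a) ^ k / fact k) * indicator {a..t} y \<partial>lborel)"
    using Suc.prems AE_lborel_singleton[of a] AE_lborel_singleton[of t]
    by (intro nn_integral_cong_AE) (auto simp: indicator_def elim!: eventually_elim2)
  also have "\<dots> = ennreal ((t - a) ^ Suc k / fact (Suc k) - (a - a) ^ Suc k / fact (Suc k))"
  proof (rule nn_integral_FTC_Icc)
    fix y :: real
    have "((\<lambda>y. (y - a) ^ Suc k / fact (Suc k)) has_real_derivative real (Suc k) * (y - a) ^ k / fact (Suc k)) (at y)"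
      by (auto intro!: derivative_eq_intros simp del: fact_Suc power_Suc)
    also have "real (Suc k) * (y - a) ^ k / fact (Suc k) = (y - a) ^ k / fact k"
      by (simp del: of_nat_Suc)
    finally show "((\<lambda>y. (y - a) ^ Suc k / fact (Suc k)) has_real_derivative (y - a) ^ k / fact k) (at y)" .
  qed (use Suc.prems in auto)
  also have "((t - a) ^ Suc k / fact (Suc k) - (a - a) ^ Suc k / fact (Suc k)) = (t - a) ^ Suc k / fact (Suc k)"
    by simp
  finally show ?case .
qed

section \<open>The cost of one decision against a random future\<close>

lemma emeasure_unif_greaterThanLessThan:
  "0 \<le> s \<Longrightarrow> s \<le> t \<Longrightarrow> t \<le> 1 \<Longrightarrow> emeasure unif {s<..<t} = ennreal (t - s)"
  by (subst emeasure_unif) auto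

lemma emeasure_unif_lessThan:
  assumes "0 \<le> t" "t \<le> 1"
  shows "emeasure unif {..<t} = ennreal t"
proof -
  have "{0..1} \<inter> {..<t} = {0..<t}" using assms by auto
  then show ?thesis using assms by (simp add: divide_ennreal_def)
qed

lemma emeasure_unif_atMost:
  assumes "0 \<le> t" "t \<le> 1"
  shows "emeasure unif {..t} = ennreal t"
proof -
  have "{0..1} \<inter> {..t} = {0..t}" using assms by auto
  then show ?thesis using assms by (simp add: divide_ennreal_def)
qed

lemma emeasure_unif_box:
  assumes "finite J" "B \<in> sets borel"
  shows "emeasure (PiM J (\<lambda>_. unif)) (PiE J (\<lambda>_. B)) = emeasure unif B ^ card J"
proof -
  interpret product_sigma_finite "\<lambda>_. unif" by (rule product_sigma_finite_unif)
  show ?thesis using assms by (subst emeasure_PiM) auto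
qed

text \<open>The alternatives \<open>P\<close> and \<open>\<not> P\<close> are the events that the selection respectively the rejection
  of a value \<open>s\<close> is a mistake, if the values indexed by \<open>J\<close> are still to come.\<close>

lemma mistake_cost:
  fixes J :: "nat set"
  assumes s: "b / 2 \<le> s" "s < b" "b < 1" and J: "finite J" "J \<noteq> {}"
  defines "M \<equiv> PiM J (\<lambda>_. unif)"
  shows "ennreal (1 - b) * emeasure M {y\<in>space M. \<forall>j\<in>J. s < y j \<and> y j < b}
    \<le> emeasure M {y\<in>space M. if P then \<exists>j\<in>J. s < y j else \<forall>j\<in>J. y j < s}"
proof -
  interpret prob_space M unfolding M_def by (rule prob_space_PiM_unif)
  have s0: "0 < s" using s by linarith
  have sp: "space M = PiE J (\<lambda>_. UNIV)" unfolding M_def by (simp add: space_PiM)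
  have up: "emeasure M {y\<in>space M. \<forall>j\<in>J. s < y j \<and> y j < b} = ennreal ((b - s) ^ card J)"
  proof -
    have "{y\<in>space M. \<forall>j\<in>J. s < y j \<and> y j < b} = PiE J (\<lambda>_. {s<..<b})"
      unfolding sp by (auto simp: PiE_def Pi_def)
    then show ?thesis using s s0 J unfolding M_def
      by (simp add: emeasure_unif_box emeasure_unif_greaterThanLessThan ennreal_power del: emeasure_uniform_measure)
  qed
  show ?thesis
  proof (cases P)
    case False
    have "{y\<in>space M. \<forall>j\<in>J. y j < s} = PiE J (\<lambda>_. {..<s})"
      unfolding sp by (auto simp: PiE_def Pi_def)
    then have "emeasure M {y\<in>space M. \<forall>j\<in>J. y j < s} = ennreal (s ^ card J)"
      using s s0 J unfolding M_def
      by (simp add: emeasure_unif_box emeasure_unif_lessThan ennreal_power del: emeasure_uniform_measure)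
    \<comment> \<open>\<open>b / 2 \<le> s\<close> gives \<open>b - s \<le> s\<close>: a value below
      \<open>s\<close> is at least as likely as one in \<open>(s, b)\<close>.\<close>
    moreover have "(1 - b) * (b - s) ^ card J \<le> 1 * s ^ card J"
      using s s0 by (intro mult_mono power_mono) auto
    ultimately show ?thesis
      using False s s0 by (simp add: up ennreal_mult [symmetric])
  next
    case True
    have box: "{y\<in>space M. \<forall>j\<in>J. y j \<le> s} = PiE J (\<lambda>_. {..s})"
      unfolding sp by (auto simp: PiE_def Pi_def)
    have ms: "{y\<in>space M. \<forall>j\<in>J. y j \<le> s} \<in> events"
      unfolding box unfolding M_def using J by (intro sets_PiM_I_finite) auto
    have "emeasure M {y\<in>space M. \<forall>j\<in>J. y j \<le> s} = ennreal (s ^ card J)"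
      unfolding box using s s0 J unfolding M_def
      by (simp add: emeasure_unif_box emeasure_unif_atMost ennreal_power del: emeasure_uniform_measure)
    then have p: "prob {y\<in>space M. \<forall>j\<in>J. y j \<le> s} = s ^ card J"
      using s0 by (simp add: measure_def)
    have "{y\<in>space M. \<exists>j\<in>J. s < y j} = space M - {y\<in>space M. \<forall>j\<in>J. y j \<le> s}"
      by (auto simp: not_le)
    then have p': "prob {y\<in>space M. \<exists>j\<in>J. s < y j} = 1 - s ^ card J"
      using prob_compl [OF ms] p by simp
    \<comment> \<open>The estimate runs through
      \<open>1 - b \<le> 1 - s \<le> 1 - s ^ card J\<close>; the last inequality uses that
      \<open>J\<close> is nonempty.\<close>
    have "(1 - b) * (b - s) ^ card J \<le> (1 - b) * 1"
      using s s0 by (intro mult_left_mono power_le_one) auto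
    also have "\<dots> \<le> 1 - s"
      using s by simp
    also have "\<dots> \<le> prob {y\<in>space M. \<exists>j\<in>J. s < y j}"
      using J s s0 power_decreasing [of 1 "card J" s] unfolding p' by (simp add: Suc_le_eq card_gt_0_iff)
    finally have "(1 - b) * (b - s) ^ card J \<le> prob {y\<in>space M. \<exists>j\<in>J. s < y j}" .
    then show ?thesis
      using True s unfolding up by (simp add: ennreal_mult [symmetric] emeasure_eq_measure)
  qed
qed

section \<open>Averaging the cost over the past\<close>

lemma sets_stop:
  fixes i n :: nat
  defines "M \<equiv> \<lambda>I::nat set. PiM I (\<lambda>_. unif)"
  assumes i: "1 \<le> i" "i < n"
    and G [measurable]: "Measurable.pred (M {1..i}) G" and T [measurable]: "Measurable.pred (M {1..i}) T"
  shows "{x\<in>space (M {1..n}). G (restrict x {1..i}) \<and> (\<forall>j\<in>{i<..n}. x i < x j \<and> x j < b)} \<in> sets (M {1..n})"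
    and "{x\<in>space (M {1..n}). G (restrict x {1..i}) \<and>
      (if T (restrict x {1..i}) then \<exists>j\<in>{i<..n}. x i < x j else \<forall>j\<in>{i<..n}. x j < x i)} \<in> sets (M {1..n})"
proof -
  have [measurable]: "(\<lambda>x. restrict x {1..i}) \<in> M {1..n} \<rightarrow>\<^sub>M M {1..i}"
    unfolding M_def using i by (intro measurable_restrict_subset) auto
  have c: "(\<lambda>x. x j) \<in> M {1..n} \<rightarrow>\<^sub>M borel" if "j \<in> {1..n}" for j
    unfolding M_def using measurable_component_singleton [OF that, of "\<lambda>_. unif"]
    by (simp cong: measurable_cong_sets del: One_nat_def)
  have [measurable]: "(\<lambda>x. x i) \<in> M {1..n} \<rightarrow>\<^sub>M borel" "\<And>j. j \<in> {i<..n} \<Longrightarrow> (\<lambda>x. x j) \<in> M {1..n} \<rightarrow>\<^sub>M borel"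
    using i by (auto intro!: c simp del: One_nat_def)
  show "{x\<in>space (M {1..n}). G (restrict x {1..i}) \<and> (\<forall>j\<in>{i<..n}. x i < x j \<and> x j < b)} \<in> sets (M {1..n})"
    by measurable
  show "{x\<in>space (M {1..n}). G (restrict x {1..i}) \<and>
      (if T (restrict x {1..i}) then \<exists>j\<in>{i<..n}. x i < x j else \<forall>j\<in>{i<..n}. x j < x i)} \<in> sets (M {1..n})"
    by measurable
qed

text \<open>By Fubini, fix the first \<open>i\<close> values. This fixes the truth of
  \<open>G\<close> and \<open>T\<close>, while the later values remain independent of them. If
  \<open>G\<close> fails, the slice on the left is empty; otherwise the slices compare by
  \<open>mistake_cost\<close> with \<open>s = x i\<close>. In the application \<open>G\<close> says
  that the algorithm stops at \<open>i\<close> along a chain and \<open>T\<close> that it selects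
  there.\<close>

lemma stop_cost:
  fixes i n :: nat
  defines "M \<equiv> \<lambda>I::nat set. PiM I (\<lambda>_. unif)"
  assumes i: "1 \<le> i" "i < n" and b: "b < 1"
    and G: "Measurable.pred (M {1..i}) G" and T: "Measurable.pred (M {1..i}) T"
    and Gb: "\<And>x. G x \<Longrightarrow> b / 2 \<le> x i \<and> x i < b"
  shows "ennreal (1 - b) * emeasure (M {1..n}) {x\<in>space (M {1..n}). G (restrict x {1..i}) \<and>
      (\<forall>j\<in>{i<..n}. x i < x j \<and> x j < b)}
    \<le> emeasure (M {1..n}) {x\<in>space (M {1..n}). G (restrict x {1..i}) \<and>
      (if T (restrict x {1..i}) then \<exists>j\<in>{i<..n}. x i < x j else \<forall>j\<in>{i<..n}. x j < x i)}"
    (is "_ * emeasure _ ?Q \<le> emeasure _ ?R")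
proof -
  interpret product_sigma_finite "\<lambda>_::nat. unif" by (rule product_sigma_finite_unif)
  let ?I = "{1..i}" and ?J = "{i<..n}"
  have IJ: "{1..n} = ?I \<union> ?J" "?I \<inter> ?J = {}" using i by auto
  have Q: "?Q \<in> sets (M {1..n})"
    using sets_stop(1) [OF i G [unfolded M_def] T [unfolded M_def]] unfolding M_def .
  have R: "?R \<in> sets (M {1..n})"
    using sets_stop(2) [OF i G [unfolded M_def] T [unfolded M_def]] unfolding M_def .
  have fold: "emeasure (M {1..n}) A = (\<integral>\<^sup>+x. \<integral>\<^sup>+y. indicator A (merge ?I ?J (x, y)) \<partial>M ?J \<partial>M ?I)"
    if "A \<in> sets (M {1..n})" for A
    using product_nn_integral_fold [OF IJ(2), of "indicator A"] that
    unfolding M_def IJ(1) by simp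
  have merge: "merge ?I ?J (x, y) \<in> space (M {1..n})" "restrict (merge ?I ?J (x, y)) ?I = x"
    "merge ?I ?J (x, y) i = x i" "\<And>j. j \<in> ?J \<Longrightarrow> merge ?I ?J (x, y) j = y j"
    if "x \<in> space (M ?I)" "y \<in> space (M ?J)" for x y
    using that i by (auto simp: M_def space_PiM PiE_def extensional_def merge_def restrict_def fun_eq_iff)
  have meas: "{y\<in>space (M ?J). if P then \<exists>j\<in>?J. s < y j else \<forall>j\<in>?J. y j < s} \<in> sets (M ?J)" 
    "{y\<in>space (M ?J). \<forall>j\<in>?J. s < y j \<and> y j < b} \<in> sets (M ?J)" for s and P
    unfolding M_def by measurable
  have "ennreal (1 - b) * emeasure (M {1..n}) ?Q
      = (\<integral>\<^sup>+x. ennreal (1 - b) * (\<integral>\<^sup>+y. indicator ?Q (merge ?I ?J (x, y)) \<partial>M ?J) \<partial>M ?I)"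
    unfolding fold [OF Q]
  proof (rule nn_integral_cmult [symmetric])
    show "(\<lambda>x. \<integral>\<^sup>+y. indicator ?Q (merge ?I ?J (x, y)) \<partial>M ?J) \<in> borel_measurable (M ?I)"
    proof -
      interpret J: sigma_finite_measure "M ?J"
        unfolding M_def by (intro prob_space_imp_sigma_finite prob_space_PiM_unif)
      have "merge ?I ?J \<in> M ?I \<Otimes>\<^sub>M M ?J \<rightarrow>\<^sub>M M {1..n}"
        unfolding M_def IJ(1) by (rule measurable_merge)
      then have "(\<lambda>p. indicator ?Q (merge ?I ?J p) :: ennreal) \<in> borel_measurable (M ?I \<Otimes>\<^sub>M M ?J)"
        by (rule measurable_compose) (rule borel_measurable_indicator [OF Q])
      then show ?thesis
        by (intro J.borel_measurable_nn_integral) (simp add: case_prod_beta')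
    qed
  qed
  also have "\<dots> \<le> (\<integral>\<^sup>+x. \<integral>\<^sup>+y. indicator ?R (merge ?I ?J (x, y)) \<partial>M ?J \<partial>M ?I)"
  proof (rule nn_integral_mono)
    fix x assume x: "x \<in> space (M ?I)"
    show "ennreal (1 - b) * (\<integral>\<^sup>+y. indicator ?Q (merge ?I ?J (x, y)) \<partial>M ?J)
      \<le> (\<integral>\<^sup>+y. indicator ?R (merge ?I ?J (x, y)) \<partial>M ?J)"
    proof (cases "G x")
      case False
      have "(\<integral>\<^sup>+y. indicator ?Q (merge ?I ?J (x, y)) \<partial>M ?J) = (\<integral>\<^sup>+y. 0 \<partial>M ?J)"
        using False x by (intro nn_integral_cong) (simp add: merge indicator_def del: One_nat_def)
      then show ?thesis by simp
    next
      case True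
      have "(\<integral>\<^sup>+y. indicator ?Q (merge ?I ?J (x, y)) \<partial>M ?J)
        = (\<integral>\<^sup>+y. indicator {y\<in>space (M ?J). \<forall>j\<in>?J. x i < y j \<and> y j < b} y \<partial>M ?J)"
        using True x by (intro nn_integral_cong) (simp add: merge indicator_def del: One_nat_def)
      moreover have "(\<integral>\<^sup>+y. indicator ?R (merge ?I ?J (x, y)) \<partial>M ?J)
        = (\<integral>\<^sup>+y. indicator {y\<in>space (M ?J). if T x then \<exists>j\<in>?J. x i < y j else \<forall>j\<in>?J. y j < x i} y \<partial>M ?J)"
        using True x by (intro nn_integral_cong) (simp add: merge indicator_def del: One_nat_def)
      ultimately show ?thesis
        using mistake_cost [of b "x i" ?J "T x"] Gb [OF True] b i meas
        unfolding nn_integral_indicator [OF meas(1)] nn_integral_indicator [OF meas(2)]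
        by (simp add: M_def)
    qed
  qed
  finally show ?thesis unfolding fold [OF R] .
qed

section \<open>The first departure from asking and rejecting\<close>

text \<open>At step \<open>i\<close>, if all calls so far were answered NO, the algorithm makes a call and rejects the
  current value upon the answer NO.\<close>

definition continues :: "algorithm \<Rightarrow> real \<Rightarrow> nat \<Rightarrow> (nat \<Rightarrow> real) \<Rightarrow> bool" where
  "continues A u i x \<longleftrightarrow>
     asks A i u x (replicate (i - 1) (Some False)) \<and> \<not> takes A i u x (replicate i (Some False))"

text \<open>The hypothetical transcript of NO answers inside \<open>continues\<close> makes this an
  event of the first \<open>i\<close> values; along a chain it is the actual transcript. The guard
  \<open>i \<le> m\<close> makes step \<open>m + 1\<close> a stop whenever no earlier step is one,
  as the budget is then exhausted.\<close>

definition stops :: "nat \<Rightarrow> algorithm \<Rightarrow> real \<Rightarrow> nat \<Rightarrow> (nat \<Rightarrow> real) \<Rightarrow> bool" where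
  "stops m A u i x \<longleftrightarrow>
     (\<forall>j\<in>{1..<i}. continues A u j (restrict x {1..j})) \<and> (i \<le> m \<longrightarrow> \<not> continues A u i (restrict x {1..i}))"

text \<open>The decision at a stop, read off from the past alone. If a call is made within the
  budget, stopping means selecting upon NO, so it counts as a selection; on the mistake event a
  later value is larger and the answer is indeed NO. Otherwise the entry of the transcript is
  \<open>None\<close>.\<close>

definition takes_uninformed :: "nat \<Rightarrow> algorithm \<Rightarrow> real \<Rightarrow> nat \<Rightarrow> (nat \<Rightarrow> real) \<Rightarrow> bool" where
  "takes_uninformed m A u i x \<longleftrightarrow>
     i \<le> m \<and> asks A i u x (replicate (i - 1) (Some False)) \<or>
     takes A i u x (replicate (i - 1) (Some False) @ [None])"

lemma calls_replicate_Some: "calls (replicate k (Some b)) = k"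
  by (simp add: calls_def)

text \<open>In a chain each value is exceeded by its successor, so every answer is NO. The chain has
  to reach \<open>Suc k\<close> to refute step \<open>k\<close>, with \<open>k < n\<close> making
  that value a realization. \<open>k \<le> m\<close> ensures that all these calls are
  answered.\<close>

lemma transcript_continues:
  assumes "\<And>j. j \<in> {1..k} \<Longrightarrow> continues A u j (restrict x {1..j})"
    and "k \<le> m" "k < n" "strict_mono_on {1..Suc k} x"
  shows "transcript m n A u x k = replicate k (Some False)"
  using assms
proof (induction k)
  case (Suc k)
  have "transcript m n A u x k = replicate k (Some False)"
    using Suc.prems by (intro Suc.IH) (auto simp: strict_mono_on_def)
  moreover have "asks A (Suc k) u (restrict x {1..Suc k}) (replicate k (Some False))"
    using Suc.prems(1) [of "Suc k"] by (simp add: continues_def del: One_nat_def restrict_apply)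
  moreover have "x (Suc k) < x (Suc (Suc k))"
    using Suc.prems(4) by (auto simp: strict_mono_on_def)
  then have "\<not> oracle_yes n x (Suc k)"
    using Suc.prems(3) by (auto simp: oracle_yes_def not_less intro!: bexI [of _ "Suc (Suc k)"])
  ultimately show ?case
    using Suc.prems(2) by (simp add: calls_replicate_Some Let_def replicate_append_same)
qed simp

text \<open>All values before \<open>i\<close> are rejected. If \<open>x i\<close> is taken, a
  larger value follows; if it is rejected, anything selected later is smaller than
  \<open>x i\<close>.\<close>

lemma stops_mistake:
  assumes i: "i \<in> {1..m + 1}" "i < n" and x: "strict_mono_on {1..i} x"
    and st: "stops m A u i x"
    and bad: "if takes_uninformed m A u i (restrict x {1..i})
      then \<exists>j\<in>{i<..n}. x i < x j else \<forall>j\<in>{i<..n}. x j < x i"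
  shows "\<not> (\<exists>k. selects m n A u x k \<and> x k = Max (x ` {1..n}))"
proof
  let ?no = "\<lambda>k. replicate k (Some False)"
  assume "\<exists>k. selects m n A u x k \<and> x k = Max (x ` {1..n})"
  then obtain k where k: "selects m n A u x k" "x k = Max (x ` {1..n})" by blast
  have max: "x j \<le> x k" if "j \<in> {1..n}" for j
    using that unfolding k(2) by simp
  have k': "k \<in> {1..n}" "accepts m n A u x k" "\<And>l. l \<in> {1..<k} \<Longrightarrow> \<not> accepts m n A u x l"
    using k(1) by (auto simp: selects_def)
  have cont: "continues A u j (restrict x {1..j})" if "j \<in> {1..<i}" for j
    using st that by (auto simp: stops_def)
  have tr: "transcript m n A u x j = ?no j" if "j < i" for j
    using that i x cont by (intro transcript_continues) (auto simp: strict_mono_on_def)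
  have rej: "\<not> accepts m n A u x j" if "j \<in> {1..<i}" for j
    using cont [OF that] that by (simp add: accepts_def tr continues_def)
  then have ki: "i \<le> k" using k' by (meson atLeastAtMost_iff atLeastLessThan_iff not_le)
  obtain i' where i': "i = Suc i'" using i(1) by (cases i) auto
  \<comment> \<open>The \<open>i'\<close> earlier steps have used \<open>i'\<close> calls, so the
    budget condition \<open>i' < m\<close> is \<open>i \<le> m\<close>.\<close>
  have tri: "transcript m n A u x i = ?no i' @ [if i' < m \<and> asks A i u (restrict x {1..i}) (?no i')
      then Some (oracle_yes n x i) else None]"
    unfolding i' by (simp add: tr [of i'] i' calls_replicate_Some Let_def)
  show False
  proof (cases "takes_uninformed m A u i (restrict x {1..i})")
    case True
    then obtain j where j: "j \<in> {i<..n}" "x i < x j" using bad by auto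
    \<comment> \<open>The larger later value that makes the selection wrong also forces the answer
      NO.\<close>
    have no: "\<not> oracle_yes n x i" using j by (auto simp: oracle_yes_def not_less intro!: bexI [of _ j])
    have "accepts m n A u x i"
    proof (cases "i \<le> m \<and> asks A i u (restrict x {1..i}) (?no i')")
      case asks: True
      then have "takes A i u (restrict x {1..i}) (?no i)"
        using st by (auto simp: stops_def continues_def i')
      then show ?thesis
        using asks no unfolding accepts_def tri by (simp add: i' replicate_append_same)
    next
      case False
      then show ?thesis
        using True unfolding accepts_def tri by (auto simp: takes_uninformed_def i')
    qed
    then have "k = i" using k'(3) [of i] ki i by force
    then show False using max [of j] j by auto
  next
    case False
    then have bad': "x j < x i" if "j \<in> {i<..n}" for j using bad that by auto
    have "\<not> accepts m n A u x i"
      using False unfolding accepts_def tri by (auto simp: takes_uninformed_def i')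
    then have "i < k" using k'(2) ki by (cases "i = k") auto
    then show False using bad' [of k] max [of i] k'(1) i by auto
  qed
qed

lemma stops_exists: "\<exists>i\<in>{1..m + 1}. stops m A u i x"
proof -
  define P where "P i \<longleftrightarrow> 1 \<le> i \<and> (i \<le> m \<longrightarrow> \<not> continues A u i (restrict x {1..i}))" for i
  \<comment> \<open>Beyond the budget the condition is vacuous, so the least such step exists and is
    at most \<open>m + 1\<close>.\<close>
  have "P (m + 1)" by (simp add: P_def)
  then have "P (LEAST i. P i)" "(LEAST i. P i) \<le> m + 1"
    by (auto intro: LeastI Least_le)
  moreover have "continues A u j (restrict x {1..j})" if "1 \<le> j" "j < (LEAST i. P i)" for j
    using not_less_Least [OF that(2)] that(1) by (simp add: P_def)
  ultimately show ?thesis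
    by (intro bexI [of _ "LEAST i. P i"]) (auto simp: P_def stops_def)
qed

text \<open>The smaller of two distinct stops would be at most \<open>m\<close>, hence not
  continuing, while the larger stop requires it to continue.\<close>

lemma stops_unique:
  assumes "stops m A u i x" "stops m A u j x" "i \<in> {1..m + 1}" "j \<in> {1..m + 1}"
  shows "i = j"
  using assms by (cases i j rule: linorder_cases) (auto simp: stops_def)

section \<open>Measurability for a fixed seed\<close>

lemma asks_takes_pred:
  assumes "is_algorithm n A" "j \<in> {1..n}"
  shows "Measurable.pred (PiM {1..j} (\<lambda>_. unif)) (\<lambda>x. asks A j u x h)"
    and "Measurable.pred (PiM {1..j} (\<lambda>_. unif)) (\<lambda>x. takes A j u x h)"
proof -
  have u: "Pair u \<in> PiM {1..j} (\<lambda>_. unif) \<rightarrow>\<^sub>M borel \<Otimes>\<^sub>M PiM {1..j} (\<lambda>_. borel)"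
    using sets_PiM_unif [of "{1..j}"] by (simp cong: measurable_cong_sets del: One_nat_def)
  have *: "Measurable.pred (borel \<Otimes>\<^sub>M PiM {1..j} (\<lambda>_. borel)) (\<lambda>(u, x). asks A j u x h)"
     "Measurable.pred (borel \<Otimes>\<^sub>M PiM {1..j} (\<lambda>_. borel)) (\<lambda>(u, x). takes A j u x h)"
    using assms by (auto simp: is_algorithm_def)
  show "Measurable.pred (PiM {1..j} (\<lambda>_. unif)) (\<lambda>x. asks A j u x h)"
    using measurable_compose [OF u *(1)] by simp
  show "Measurable.pred (PiM {1..j} (\<lambda>_. unif)) (\<lambda>x. takes A j u x h)"
    using measurable_compose [OF u *(2)] by simp
qed

lemma stops_pred:
  assumes "is_algorithm n A" "i \<in> {1..n}"
  shows "Measurable.pred (PiM {1..i} (\<lambda>_. unif)) (stops m A u i)"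
    and "Measurable.pred (PiM {1..i} (\<lambda>_. unif)) (takes_uninformed m A u i)"
proof -
  have c: "Measurable.pred (PiM {1..i} (\<lambda>_. unif)) (\<lambda>x. continues A u j (restrict x {1..j}))"
    if "j \<in> {1..i}" for j
  proof -
    have j: "j \<in> {1..n}" using that assms by auto
    have "Measurable.pred (PiM {1..j} (\<lambda>_. unif)) (continues A u j)"
      unfolding continues_def [abs_def]
      using asks_takes_pred [OF assms(1) j] by (intro pred_intros_logic)
    moreover have "(\<lambda>x. restrict x {1..j}) \<in> PiM {1..i} (\<lambda>_. unif) \<rightarrow>\<^sub>M PiM {1..j} (\<lambda>_. unif)"
      using that by (intro measurable_restrict_subset) auto
    ultimately show ?thesis by (rule measurable_compose [rotated])
  qed
  show "Measurable.pred (PiM {1..i} (\<lambda>_. unif)) (stops m A u i)"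
    unfolding stops_def [abs_def] using c assms(2)
    by (intro pred_intros_logic pred_intros_finite) auto
  show "Measurable.pred (PiM {1..i} (\<lambda>_. unif)) (takes_uninformed m A u i)"
    unfolding takes_uninformed_def [abs_def]
    using asks_takes_pred [OF assms] by (intro pred_intros_logic) auto
qed

section \<open>The failure probability under the uniform distribution\<close>

text \<open>The seed is fixed and \<open>S\<close> is a measurable set of successful sequences. The
  events \<open>Q i\<close> cover the chains \<open>C\<close> according to the stopping step, and
  \<open>stop_cost\<close> trades each for an event \<open>R i\<close> of failures. Since stops are
  unique, the \<open>R i\<close> are disjoint and their probabilities add up.\<close>

lemma failure_lower_bound:
  fixes m :: nat
  defines "n \<equiv> m + 2"
  defines "M \<equiv> PiM {1..n} (\<lambda>_. unif)"
  assumes A: "is_algorithm n A" and b: "0 < b" "b < 1"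
    and S: "S \<in> sets M" "\<And>x. x \<in> S \<Longrightarrow> \<exists>i. selects m n A u x i \<and> x i = Max (x ` {1..n})"
  shows "emeasure M S \<le> ennreal (1 - (1 - b) * (b / 2) ^ n / fact n)"
proof -
  interpret prob_space M unfolding M_def by (rule prob_space_PiM_unif)
  let ?I = "{1..m + 1}"
  define G where "G i x \<longleftrightarrow> strict_mono_on {1..i} x \<and> (\<forall>j\<in>{1..i}. b / 2 < x j \<and> x j < b) \<and> stops m A u i x"
    for i and x :: "nat \<Rightarrow> real"
  define T where "T i = takes_uninformed m A u i" for i
  \<comment> \<open>The future values are only required to lie in \<open>(x i, b)\<close>, in any
    order, so that given the past they form a box.\<close>
  define Q where "Q i = {x\<in>space M. G i (restrict x {1..i}) \<and> (\<forall>j\<in>{i<..n}. x i < x j \<and> x j < b)}" for i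
  define R where "R i = {x\<in>space M. G i (restrict x {1..i}) \<and>
    (if T i (restrict x {1..i}) then \<exists>j\<in>{i<..n}. x i < x j else \<forall>j\<in>{i<..n}. x j < x i)}" for i
  define C where "C = {x\<in>space M. strict_mono_on {1..n} x \<and> (\<forall>j\<in>{1..n}. b / 2 < x j \<and> x j < b)}"
  have inI: "1 \<le> i" "i < n" "i \<in> {1..n}" if "i \<in> ?I" for i
    using that by (auto simp: n_def)
  have Gm [measurable]: "Measurable.pred (PiM {1..i} (\<lambda>_. unif)) (G i)" if "i \<in> ?I" for i
    using stops_pred(1) [OF A, of i] inI [OF that] unfolding G_def [abs_def]
    by (intro pred_intros_logic pred_intros_finite strict_mono_on_pred) (measurable, auto)
  have Tm [measurable]: "Measurable.pred (PiM {1..i} (\<lambda>_. unif)) (T i)" if "i \<in> ?I" for i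
    unfolding T_def using that by (intro stops_pred [OF A] inI)
  \<comment> \<open>Only coordinates up to \<open>i\<close> are read, so \<open>G i\<close> can be
    measured on the past and evaluated on full sequences.\<close>
  have stops_restrict: "stops m A u i (restrict x {1..i}) = stops m A u i x" for i x
    by (auto simp: stops_def Int_absorb1 min_def restrict_restrict intro!: ball_cong)
  have G_restrict: "G i (restrict x {1..i}) = G i x" for i x
    by (auto simp: G_def stops_restrict strict_mono_on_def simp del: One_nat_def)
  have QR: "ennreal (1 - b) * emeasure M (Q i) \<le> emeasure M (R i)" if "i \<in> ?I" for i
  proof -
    have "b / 2 \<le> x i \<and> x i < b" if "G i x" for x
      using that inI [OF \<open>i \<in> ?I\<close>] by (auto simp: G_def intro: less_imp_le)
    then show ?thesis
      unfolding Q_def R_def M_def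
      using stop_cost [OF inI(1,2) [OF that] b(2) Gm [OF that] Tm [OF that]] by blast
  qed
  have sets: "Q i \<in> events" "R i \<in> events" if "i \<in> ?I" for i
    unfolding Q_def R_def M_def
    by (rule sets_stop [OF inI(1,2) [OF that] Gm [OF that] Tm [OF that]])+
  have sub: "C \<subseteq> (\<Union>i\<in>?I. Q i)"
  proof
    fix x assume x: "x \<in> C"
    obtain i where i: "i \<in> ?I" "stops m A u i x" using stops_exists by blast
    have "G i x" "x \<in> space M"
      using x i inI [OF i(1)] by (auto simp: C_def G_def strict_mono_on_def)
    moreover have "\<forall>j\<in>{i<..n}. x i < x j \<and> x j < b"
      using x inI [OF i(1)] by (auto simp: C_def strict_mono_on_def)
    ultimately have "x \<in> Q i"
      unfolding Q_def G_restrict by blast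
    then show "x \<in> (\<Union>i\<in>?I. Q i)" using i(1) by blast
  qed
  have disj: "disjoint_family_on R ?I"
  proof (unfold disjoint_family_on_def, intro ballI impI)
    fix i j assume ij: "i \<in> ?I" "j \<in> ?I" "i \<noteq> j"
    have "stops m A u k x" if "x \<in> R k" for k x
      using that unfolding R_def G_restrict by (simp add: G_def)
    then show "R i \<inter> R j = {}" using stops_unique [OF _ _ ij(1,2)] ij(3) by blast
  qed
  have fail: "S \<inter> (\<Union>i\<in>?I. R i) = {}"
  proof -
    have False if i: "i \<in> ?I" and x: "x \<in> S" "x \<in> R i" for i x
    proof -
      have "strict_mono_on {1..i} x" "stops m A u i x"
        "if takes_uninformed m A u i (restrict x {1..i})
          then \<exists>j\<in>{i<..n}. x i < x j else \<forall>j\<in>{i<..n}. x j < x i"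
        using x(2) unfolding R_def G_restrict by (simp_all add: G_def T_def)
      then show False
        using stops_mistake [OF i inI(2) [OF i]] S(2) [OF x(1)] by blast
    qed
    then show ?thesis by blast
  qed
  have "ennreal ((1 - b) * (b / 2) ^ n / fact n) = ennreal (1 - b) * emeasure M C"
    using emeasure_chain [of "b / 2" b n] b by (simp add: C_def M_def ennreal_mult [symmetric])
  also have "\<dots> \<le> ennreal (1 - b) * (\<Sum>i\<in>?I. emeasure M (Q i))"
    using sub sets by (intro mult_left_mono order.trans [OF emeasure_mono emeasure_subadditive_finite]) auto
  also have "\<dots> = (\<Sum>i\<in>?I. ennreal (1 - b) * emeasure M (Q i))"
    by (rule sum_distrib_left)
  also have "\<dots> \<le> (\<Sum>i\<in>?I. emeasure M (R i))"
    by (intro sum_mono QR)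
  also have "\<dots> = emeasure M (\<Union>i\<in>?I. R i)"
    using sets disj by (intro sum_emeasure) auto
  finally have *: "(1 - b) * (b / 2) ^ n / fact n \<le> prob (\<Union>i\<in>?I. R i)"
    by (simp add: emeasure_eq_measure del: of_nat_Suc)
  have "prob (S \<union> (\<Union>i\<in>?I. R i)) = prob S + prob (\<Union>i\<in>?I. R i)"
    using sets S(1) fail by (intro finite_measure_Union) auto
  then have "prob S \<le> 1 - (1 - b) * (b / 2) ^ n / fact n"
    using * prob_le_1 [of "S \<union> (\<Union>i\<in>?I. R i)"] by linarith
  then show ?thesis by (simp add: emeasure_eq_measure ennreal_leI)
qed

text \<open>For each seed \<open>u\<close> the algorithm is deterministic and the section of the
  success event obeys \<open>failure_lower_bound\<close>; the bound does not depend on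
  \<open>u\<close>, so it survives integration over the seed.\<close>

lemma success_prob_le:
  fixes m :: nat
  defines "n \<equiv> m + 2"
  assumes A: "is_algorithm n A" and b: "0 < b" "b < 1"
  shows "success_prob m n unif A \<le> 1 - (1 - b) * (b / 2) ^ n / fact n"
proof -
  let ?M = "PiM {1..n} (\<lambda>_. unif)"
  let ?q = "1 - (1 - b) * (b / 2) ^ n / fact n"
  interpret seed: real_distribution "seed A" using A by (simp add: is_algorithm_def)
  interpret M: prob_space ?M by (rule prob_space_PiM_unif)
  define S where "S = {p\<in>space (seed A \<Otimes>\<^sub>M ?M). case p of (u, x) \<Rightarrow>
    \<exists>i. selects m n A u x i \<and> x i = Max (x ` {1..n})}"
  have "(1 - b) * (b / 2) ^ n \<le> 1 * 1"
    using b by (intro mult_mono power_le_one) auto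
  also have "1 * 1 \<le> (fact n :: real)" by simp
  finally have q: "0 \<le> ?q" by (simp add: field_simps)
  have "measure (seed A \<Otimes>\<^sub>M ?M) S \<le> ?q"
  proof (cases "S \<in> sets (seed A \<Otimes>\<^sub>M ?M)")
    \<comment> \<open>A non-measurable set has \<open>measure\<close> 0 by convention, so the bound
      reduces to its nonnegativity.\<close>
    case False
    then show ?thesis using q by (simp add: measure_notin_sets)
  next
    case True
    have "emeasure ?M (Pair u -` S) \<le> ennreal ?q" for u
      using A b sets_Pair1 [OF True, of u] unfolding n_def
      by (rule failure_lower_bound) (auto simp: S_def n_def)
    then have "emeasure (seed A \<Otimes>\<^sub>M ?M) S \<le> (\<integral>\<^sup>+u. ennreal ?q \<partial>seed A)"
      unfolding M.emeasure_pair_measure_alt [OF True] by (intro nn_integral_mono)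
    also have "\<dots> = ennreal ?q" using seed.emeasure_space_1 by simp
    finally show ?thesis using q by (simp add: measure_def enn2real_leI)
  qed
  then show ?thesis unfolding success_prob_def S_def by (simp only: case_prod_beta' prod.collapse)
qed

section \<open>Asymptotic comparison of the chain volume with the target rate\<close>

text \<open>The quotient \<open>q m\<close> of the two sides has ratio
  \<open>q (Suc m) / q m\<close> tending to \<open>r * exp 1 > 1\<close>. Hence \<open>q\<close> is
  eventually nondecreasing, and its value at the start of that range serves as
  \<open>c\<close>.\<close>

lemma simplex_volume_ge:
  fixes r :: real
  assumes "exp 1 * r > 1" "r > 0"
  shows "\<exists>c>0. \<exists>m0. \<forall>m\<ge>m0. c * real m powi (- int m) \<le> r ^ (m + 2) / fact (m + 2)"
proof -
  define q where "q m = r ^ (m + 2) * real m ^ m / fact (m + 2)" for m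
  have "(\<lambda>m. r * (1 + 1 / real m) ^ m * (real m + 1) / (real m + 3)) \<longlonglongrightarrow> r * exp 1"
    using assms by real_asymp
  then have "\<forall>\<^sub>F m in sequentially. r * (1 + 1 / real m) ^ m * (real m + 1) / (real m + 3) > 1"
    using assms by (intro order_tendstoD) (auto simp: mult.commute)
  then obtain m1 where m1: "\<And>m. m \<ge> m1 \<Longrightarrow> r * (1 + 1 / real m) ^ m * (real m + 1) / (real m + 3) > 1"
    by (auto simp: eventually_sequentially)
  define m0 where "m0 = max m1 1"
  have pos: "q m > 0" if "m \<ge> m0" for m
    using that assms by (auto simp: q_def m0_def)
  have step: "q m \<le> q (Suc m)" if "m \<ge> m0" for m
  proof -
    have m: "m \<ge> m1" "m > 0" using that by (auto simp: m0_def)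
    have "(real m + 1) ^ m = (1 + 1 / real m) ^ m * real m ^ m"
      using m by (simp add: power_mult_distrib [symmetric] field_simps)
    then have "q (Suc m) = q m * (r * (1 + 1 / real m) ^ m * (real m + 1) / (real m + 3))"
      by (simp add: q_def field_simps)
    moreover have "q m * 1 \<le> q m * (r * (1 + 1 / real m) ^ m * (real m + 1) / (real m + 3))"
      using m1 [OF m(1)] pos [OF that] by (intro mult_left_mono) auto
    ultimately show ?thesis by simp
  qed
  have q: "q m0 \<le> q m" if "m \<ge> m0" for m
    using that by (induction m rule: dec_induct) (auto intro: order.trans step)
  then have "q m0 * real m powi (- int m) \<le> r ^ (m + 2) / fact (m + 2)" if "m \<ge> m0" for m
  proof -
    have "r ^ (m + 2) / fact (m + 2) = q m * real m powi (- int m)"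
      using that by (simp add: q_def m0_def power_int_minus field_simps del: fact_Suc power_Suc)
    then show ?thesis
      using q that by (simp add: mult_right_mono del: fact_Suc power_Suc)
  qed
  then show ?thesis using pos [of m0] by blast
qed

theorem theorem4p3:
  "\<exists>c::real. c > 0 \<and> (\<exists>m0::nat. \<forall>m\<ge>m0.
     \<exists>(n::nat) (D::real measure).
       n \<ge> 1 \<and> real_distribution D \<and> continuous_on UNIV (cdf D) \<and>
       (\<forall>A. is_algorithm n A \<longrightarrow>
          success_prob m n D A \<le> 1 - c * real m powi (- int m)))"
proof -
  \<comment> \<open>Here \<open>b = 9 / 10\<close> and \<open>r = b / 2\<close>: any
    \<open>b\<close> with \<open>2 / e < b < 1\<close> would do, and
    \<open>exp 1 \<ge> 5 / 2\<close> confirms this one. The factor \<open>1 - b\<close> then turns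
    \<open>c\<close> into \<open>c / 10\<close>.\<close>
  have "exp 1 * (9 / 20) > (1 :: real)"
    using exp_lower_Taylor_quadratic [of "1 :: real"] by simp
  then obtain c m0 where c: "c > 0" and
    le: "\<And>m. m \<ge> m0 \<Longrightarrow> c * real m powi (- int m) \<le> (9 / 20) ^ (m + 2) / fact (m + 2)"
    using simplex_volume_ge [of "9 / 20"] by auto
  have "success_prob m (m + 2) unif A \<le> 1 - (c / 10) * real m powi (- int m)"
    if "m \<ge> m0" "is_algorithm (m + 2) A" for m A
  proof -
    obtain n where n: "n = m + 2" by blast
    show ?thesis
      using success_prob_le [OF that(2), of "9 / 10"] le [OF that(1)] unfolding n [symmetric] by simp
  qed
  then show ?thesis
    using c real_distribution_unif continuous_cdf_unif
    by (intro exI [of _ "c / 10"] conjI exI [of _ m0] allI impI exI [of _ "_ + 2"] exI [of _ unif]) auto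
qed

end
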